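(* For all $n\ge3$, $|\mathrm{Av}^\star_{3n}(123)|=0$. Also $|\mathrm{Av}^\star_3(123)|=2$ and $|\mathrm{Av}^\star_6(123)|=6$.
   Context: Permutations are written in one-line notation; a permutation avoids $\sigma$ if no subsequence is in the same relative order as $\sigma$. $\mathcal{S}^\star_{3n}$ is the set of permutations of $[3n]=\{1,\dots,3n\}$ whose cycle decomposition consists only of 3-cycles, and $\mathrm{Av}^\star_{3n}(123)$ the set of those avoiding 123. *)

theory Defs
  imports "HOL-Combinatorics.Combinatorics" "HOL-Library.Sublist"
begin

definition one_line :: "nat \<Rightarrow> (nat \<Rightarrow> nat) \<Rightarrow> nat list" where
  "one_line m p = map p [1..<Suc m]"

definition same_relative_order :: "nat list \<Rightarrow> nat list \<Rightarrow> bool" where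
  "same_relative_order xs ys \<longleftrightarrow>
     length xs = length ys \<and>
     (\<forall>i<length xs. \<forall>j<length xs. xs ! i < xs ! j \<longleftrightarrow> ys ! i < ys ! j)"

text \<open>The subsequence of \<open>w\<close> need not consist of consecutive entries.\<close>

definition avoids :: "nat list \<Rightarrow> nat list \<Rightarrow> bool" where
  "avoids w \<sigma> \<longleftrightarrow> \<not> (\<exists>xs. subseq xs w \<and> same_relative_order xs \<sigma>)"

text \<open>
  A cycle in the disjoint cycle decomposition of \<open>p\<close> is represented by the set of its
  elements. Fixed points count, as cycles of length 1.
\<close>

definition cycles_on :: "(nat \<Rightarrow> nat) \<Rightarrow> nat set \<Rightarrow> nat set set" where
  "cycles_on p S = {C. C \<subseteq> S \<and> cyclic_on p C}"

definition S_star :: "nat \<Rightarrow> (nat \<Rightarrow> nat) set" where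
  "S_star m = {p. p permutes {1..m} \<and> (\<forall>C\<in>cycles_on p {1..m}. card C = 3)}"

definition Av_star :: "nat \<Rightarrow> nat list \<Rightarrow> (nat \<Rightarrow> nat) set" where
  "Av_star m \<sigma> = {p \<in> S_star m. avoids (one_line m p) \<sigma>}"

text \<open>In particular \<open>card (Av_star m \<sigma>) = 0\<close> says that the set is empty.\<close>

lemma finite_Av_star: "finite (Av_star m \<sigma>)"
  by (rule finite_subset[OF _ finite_permutations[of "{1..m}"]])
     (auto simp: Av_star_def S_star_def)

end

theory Submission
  imports Defs
begin

text \<open>
  A 3-cycle with elements \<open>a < b < c\<close> is either ascending (\<open>a \<mapsto> b \<mapsto> c \<mapsto> a\<close>) or
  descending (\<open>a \<mapsto> c \<mapsto> b \<mapsto> a\<close>), and replacing \<open>p\<close> by \<open>p \<circ> p\<close>, its inverse, swaps the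
  two kinds while preserving 123-avoidance. Two ascending cycles of a 123-avoiding permutation
  are nested as \<open>a' < a < b < b' < c' < c\<close>, so three of them would give the 123-pattern
  \<open>a'' < a' < a\<close> at the positions \<open>c'' < c' < c\<close>. Hence there are at most two cycles of each
  kind, and three cycles in total would include two of one kind and one of the other; the
  possible relative orders of those nine points all contain 123.
\<close>

section \<open>123-avoidance in terms of positions\<close>

lemma subseq_upt_iff:
  "subseq xs [a..<b] \<longleftrightarrow> sorted_wrt (<) xs \<and> set xs \<subseteq> {a..<b}"
proof
  assume "subseq xs [a..<b]"
  then show "sorted_wrt (<) xs \<and> set xs \<subseteq> {a..<b}"
    by (auto simp: subseq_conv_nths strict_sorted_iff sorted_nths dest!: in_set_nthsD)
next
  assume *: "sorted_wrt (<) xs \<and> set xs \<subseteq> {a..<b}"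
  \<comment> \<open>Filtering the interval by membership in \<open>xs\<close> gives a strictly
    increasing list with the same elements, hence \<open>xs\<close> itself.\<close>
  then have "filter (\<lambda>x. x \<in> set xs) [a..<b] = xs"
    by (intro sorted_distinct_set_unique) (auto simp: strict_sorted_iff sorted_wrt_filter)
  then show "subseq xs [a..<b]"
    by (metis subseq_filter_left)
qed

lemma same_relative_order_123_iff:
  "same_relative_order xs [1, 2, 3] \<longleftrightarrow> (\<exists>u v w. xs = [u, v, w] \<and> u < v \<and> v < w)"
proof
  assume *: "same_relative_order xs [1, 2, 3]"
  then obtain u v w where xs: "xs = [u, v, w]"
    by (auto simp: same_relative_order_def length_Suc_conv)
  have "xs ! 0 < xs ! 1 \<and> xs ! 1 < xs ! 2"
    using * by (simp add: same_relative_order_def)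
  then show "\<exists>u v w. xs = [u, v, w] \<and> u < v \<and> v < w"
    using xs by simp
next
  assume "\<exists>u v w. xs = [u, v, w] \<and> u < v \<and> v < w"
  then show "same_relative_order xs [1, 2, 3]"
    by (auto simp: same_relative_order_def less_Suc_eq)
qed

lemma avoids_one_line_123_iff:
  "avoids (one_line m p) [1, 2, 3] \<longleftrightarrow>
     (\<forall>i\<in>{1..m}. \<forall>j\<in>{1..m}. \<forall>k\<in>{1..m}. i < j \<longrightarrow> j < k \<longrightarrow> p i < p j \<longrightarrow> \<not> p j < p k)"
proof -
  have "(\<exists>xs. subseq xs (one_line m p) \<and> same_relative_order xs [1, 2, 3]) \<longleftrightarrow>
        (\<exists>ys. subseq ys [1..<Suc m] \<and> same_relative_order (map p ys) [1, 2, 3])"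
    \<comment> \<open>\<open>nths\<close> commutes with \<open>map\<close>, so each subsequence of
      the word comes from a subsequence of positions.\<close>
    unfolding one_line_def subseq_conv_nths nths_map by metis
  also have "\<dots> \<longleftrightarrow> (\<exists>i j k. subseq [i, j, k] [1..<Suc m] \<and> p i < p j \<and> p j < p k)"
    unfolding same_relative_order_123_iff
    by (auto simp: map_eq_Cons_conv)
  also have "\<dots> \<longleftrightarrow> (\<exists>i\<in>{1..m}. \<exists>j\<in>{1..m}. \<exists>k\<in>{1..m}. i < j \<and> j < k \<and> p i < p j \<and> p j < p k)"
  proof -
    have "subseq [i, j, k] [1..<Suc m] \<longleftrightarrow>
        i \<in> {1..m} \<and> j \<in> {1..m} \<and> k \<in> {1..m} \<and> i < j \<and> j < k" for i j k
      unfolding subseq_upt_iff by auto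
    then show ?thesis
      by blast
  qed
  finally show ?thesis
    unfolding avoids_def by blast
qed

section \<open>3-cycles as pointwise equations\<close>

lemma orbit_cube_id:
  assumes "p (p (p x)) = x"
  shows "orbit p x = {x, p x, p (p x)}"
proof
  show "orbit p x \<subseteq> {x, p x, p (p x)}"
  proof
    fix y assume "y \<in> orbit p x"
    then show "y \<in> {x, p x, p (p x)}"
      by induction (use assms in auto)
  qed
  show "{x, p x, p (p x)} \<subseteq> orbit p x"
    using assms by (metis empty_subsetI insert_subset orbit.base orbit.step)
qed

text \<open>The iterates of \<open>x\<close> before its first return enumerate \<open>C\<close>
  without repetition, so the return takes exactly three steps.\<close>

lemma cyclic_on_card_3:
  assumes "cyclic_on p C" "card C = 3" "x \<in> C"
  shows "p x \<noteq> x" "p (p (p x)) = x"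
proof -
  have C: "orbit p x = C"
    using assms by (simp add: orbit_cyclic_eq3)
  have x: "x \<in> orbit p x"
    using assms(3) C by simp
  have "inj_on (\<lambda>k. (p ^^ k) x) {0..<funpow_dist1 p x x}"
    using x by (rule inj_on_funpow_dist1)
  then have "card (orbit p x) = funpow_dist1 p x x"
    unfolding orbit_conv_funpow_dist1[OF x] by (simp add: card_image)
  then have 3: "funpow_dist1 p x x = 3"
    using C assms(2) by simp
  show "p (p (p x)) = x"
    using funpow_dist1_prop[OF x] unfolding 3 by (simp add: numeral_3_eq_3)
  show "p x \<noteq> x"
    using C assms(2) orbit_eq_singleton_iff[of p x] by auto
qed

lemma S_star_iff:
  "p \<in> S_star m \<longleftrightarrow>
     p permutes {1..m} \<and> (\<forall>i\<in>{1..m}. p i \<noteq> i \<and> p (p (p i)) = i)"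
proof
  assume *: "p \<in> S_star m"
  then have p: "p permutes {1..m}"
    by (simp add: S_star_def)
  have "p i \<noteq> i \<and> p (p (p i)) = i" if i: "i \<in> {1..m}" for i
  proof -
    have perm: "permutation p"
      using p permutation_permutes by blast
    have "cyclic_on p (orbit p i)"
      using p finite_atLeastAtMost by (rule cyclic_on_orbit)
    moreover have "orbit p i \<subseteq> {1..m}"
      using p i by (rule permutes_orbit_subset)
    ultimately have "card (orbit p i) = 3"
      using * by (auto simp: S_star_def cycles_on_def)
    moreover have "i \<in> orbit p i"
      using perm by (rule permutation_self_in_orbit)
    ultimately show ?thesis
      using \<open>cyclic_on p (orbit p i)\<close> cyclic_on_card_3 by metis
  qed
  with p show "p permutes {1..m} \<and> (\<forall>i\<in>{1..m}. p i \<noteq> i \<and> p (p (p i)) = i)"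
    by blast
next
  assume *: "p permutes {1..m} \<and> (\<forall>i\<in>{1..m}. p i \<noteq> i \<and> p (p (p i)) = i)"
  have "card C = 3" if C: "C \<subseteq> {1..m}" "cyclic_on p C" for C
  proof -
    obtain x where x: "x \<in> C" "C = orbit p x"
      using C(2) by (auto simp: cyclic_on_def)
    then have x': "p x \<noteq> x" "p (p (p x)) = x"
      using * C(1) by auto
    \<comment> \<open>Since \<open>p\<close> has order 3 on \<open>x\<close>, any coincidence among
      the three iterates would force \<open>p x = x\<close>.\<close>
    then have "p (p x) \<noteq> p x" "p (p x) \<noteq> x"
      by metis+
    then show ?thesis
      using x x' orbit_cube_id[of p x] by simp
  qed
  with * show "p \<in> S_star m"
    by (auto simp: S_star_def cycles_on_def)
qed

text \<open>All conditions are pointwise on \<open>{1..m}\<close>, so they pass easily to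
  \<open>p \<circ> p\<close> and can be checked on an explicit list. Bijectivity on
  \<open>{1..m}\<close> is implied by \<open>closed\<close> and \<open>cube\<close>.\<close>

locale three_cycles_av123 =
  fixes p :: "nat \<Rightarrow> nat" and m :: nat
  assumes closed: "i \<in> {1..m} \<Longrightarrow> p i \<in> {1..m}"
    and no_fix: "i \<in> {1..m} \<Longrightarrow> p i \<noteq> i"
    and cube: "i \<in> {1..m} \<Longrightarrow> p (p (p i)) = i"
    and no_123: "\<lbrakk>i \<in> {1..m}; j \<in> {1..m}; k \<in> {1..m}; i < j; j < k; p i < p j\<rbrakk> \<Longrightarrow> \<not> p j < p k"

lemma Av_star_123_iff:
  "p \<in> Av_star m [1, 2, 3] \<longleftrightarrow> p permutes {1..m} \<and> three_cycles_av123 p m"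
  unfolding Av_star_def avoids_one_line_123_iff S_star_iff three_cycles_av123_def mem_Collect_eq
  by (meson permutes_in_image)

text \<open>Inverting reflects the points (position, value) in the diagonal, which sends increasing
  triples to increasing triples.\<close>

lemma (in three_cycles_av123) inverse: "three_cycles_av123 (p \<circ> p) m"
proof
  fix i assume i: "i \<in> {1..m}"
  show "(p \<circ> p) i \<in> {1..m}" "(p \<circ> p) i \<noteq> i" "(p \<circ> p) ((p \<circ> p) ((p \<circ> p) i)) = i"
    using closed no_fix cube i unfolding comp_apply by metis+
next
  fix i j k
  assume "i \<in> {1..m}" "j \<in> {1..m}" "k \<in> {1..m}" "i < j" "j < k" "(p \<circ> p) i < (p \<circ> p) j"
  then show "\<not> (p \<circ> p) j < (p \<circ> p) k"
    using no_123[of "p (p i)" "p (p j)" "p (p k)"] closed cube unfolding comp_apply by metis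
qed

section \<open>Counting cycles of each kind by their least elements\<close>

definition asc_minima :: "(nat \<Rightarrow> nat) \<Rightarrow> nat \<Rightarrow> nat set" where
  "asc_minima p m = {i \<in> {1..m}. i < p i \<and> p i < p (p i)}"

definition desc_minima :: "(nat \<Rightarrow> nat) \<Rightarrow> nat \<Rightarrow> nat set" where
  "desc_minima p m = {i \<in> {1..m}. i < p (p i) \<and> p (p i) < p i}"

lemma card_ge_3_ordered_elements:
  fixes A :: "'a::linorder set"
  assumes "finite A" "3 \<le> card A"
  obtains x y z where "x \<in> A" "y \<in> A" "z \<in> A" "x < y" "y < z"
proof -
  let ?l = "sorted_list_of_set A"
  have "length ?l = card A" "sorted_wrt (<) ?l" "set ?l = A"
    using assms(1) by auto
  then show ?thesis
    using assms(2) that[of "?l ! 0" "?l ! 1" "?l ! 2"] nth_mem[of 0 ?l] nth_mem[of 1 ?l]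
      nth_mem[of 2 ?l]
    by (simp add: sorted_wrt_iff_nth_less)
qed

lemma finite_minima [simp]: "finite (asc_minima p m)" "finite (desc_minima p m)"
  by (simp_all add: asc_minima_def desc_minima_def)

context three_cycles_av123
begin

lemma asc_minima_inverse: "asc_minima (p \<circ> p) m = desc_minima p m"
  unfolding asc_minima_def desc_minima_def using cube by auto

lemma desc_minima_inverse: "desc_minima (p \<circ> p) m = asc_minima p m"
  unfolding asc_minima_def desc_minima_def using cube by auto

text \<open>If \<open>p d < p a\<close>, the positions \<open>d < a < p a\<close> carry increasing
  values. Once \<open>p a < p d\<close> is known, \<open>p (p a) < p (p d)\<close> would make the
  values at \<open>a < p a < p d\<close> increase.\<close>

lemma asc_nested:
  assumes "d \<in> asc_minima p m" "a \<in> asc_minima p m" "d < a"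
  shows "p a < p d" "p d < p (p d)" "p (p d) < p (p a)"
proof -
  have mem: "a \<in> {1..m}" "p a \<in> {1..m}" "p (p a) \<in> {1..m}"
            "d \<in> {1..m}" "p d \<in> {1..m}" "p (p d) \<in> {1..m}"
    and ord: "a < p a" "p a < p (p a)" "d < p d" "p d < p (p d)"
    using assms closed by (auto simp: asc_minima_def)
  have "p a \<noteq> p d" "p (p a) \<noteq> p (p d)"
    using cube[of a] cube[of d] mem assms(3) by auto
  moreover have "\<not> p d < p a"
    using no_123[of d a "p a"] mem ord assms(3) by auto
  ultimately show "p a < p d"
    by simp
  moreover have "\<not> p (p a) < p (p d)"
    using no_123[of a "p a" "p d"] mem ord \<open>p a < p d\<close> by auto
  ultimately show "p (p d) < p (p a)"
    using \<open>p (p a) \<noteq> p (p d)\<close> by simp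
  show "p d < p (p d)"
    by (rule ord)
qed

lemma card_asc_minima: "card (asc_minima p m) \<le> 2"
proof (rule ccontr)
  assume "\<not> ?thesis"
  then have "3 \<le> card (asc_minima p m)"
    by simp
  then obtain x y z where xyz: "x \<in> asc_minima p m" "y \<in> asc_minima p m" "z \<in> asc_minima p m"
    and less: "x < y" "y < z"
    using card_ge_3_ordered_elements[OF finite_minima(1)] by metis
  then have "x \<in> {1..m}" "y \<in> {1..m}" "z \<in> {1..m}"
    by (auto simp: asc_minima_def)
  then show False
    using no_123[of "p (p x)" "p (p y)" "p (p z)"] asc_nested[OF xyz(1,2) less(1)]
      asc_nested[OF xyz(2,3) less(2)] less closed cube by metis
qed

text \<open>The descending cycle \<open>x < y < z\<close> is squeezed between the other points until
  \<open>y < z < e\<close> holds; these positions then carry the values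
  \<open>x < y < f\<close>.\<close>

lemma asc_asc_desc:
  assumes "d \<in> asc_minima p m" "a \<in> asc_minima p m" "d < a" "x \<in> desc_minima p m"
  shows False
proof -
  define b c e f z y where defs: "b = p a" "c = p b" "e = p d" "f = p e" "z = p x" "y = p z"
  have mem: "a \<in> {1..m}" "b \<in> {1..m}" "c \<in> {1..m}" "d \<in> {1..m}" "e \<in> {1..m}" "f \<in> {1..m}"
     "x \<in> {1..m}" "y \<in> {1..m}" "z \<in> {1..m}"
    using assms closed by (auto simp: asc_minima_def desc_minima_def defs)
  have p: "p a = b" "p b = c" "p c = a" "p d = e" "p e = f" "p f = d" "p x = z" "p z = y" "p y = x"
    using mem cube by (auto simp: defs)
  have ord: "d < a" "a < b" "b < e" "e < f" "f < c" "x < y" "y < z"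
    using asc_nested[OF assms(1-3)] assms by (auto simp: asc_minima_def desc_minima_def defs)
  have "b < c"
    using ord by linarith
  \<comment> \<open>The cycles run in opposite directions, which rules out the first coincidences;
    applying \<open>p\<close> to any of the later ones leads back to one already excluded.\<close>
  then have ne1: "x \<noteq> d" "x \<noteq> a" "y \<noteq> a" "z \<noteq> b"
    using p ord(2,4,6,7) less_asym by metis+
  then have ne2: "z \<noteq> c" "y \<noteq> f"
    using p by metis+
  then have ne3: "z \<noteq> e" "x \<noteq> b"
    using p by metis+
  have avoid: "\<not> (u < v \<and> v < w \<and> p u < p v \<and> p v < p w)"
    if "u \<in> {1..m}" "v \<in> {1..m}" "w \<in> {1..m}" for u v w
    using no_123[OF that] by blast
  \<comment> \<open>Writing points as (position, value), \<open>patterns(1)\<close> says that \<open>(y, x)\<close>, \<open>(f, d)\<close>, \<open>(c, a)\<close>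
    is not increasing; the others are read likewise off the positions and \<open>p\<close>.\<close>
  note patterns =
    avoid[OF mem(8) mem(6) mem(3), unfolded p] avoid[OF mem(4) mem(5) mem(9), unfolded p]
    avoid[OF mem(6) mem(3) mem(9), unfolded p] avoid[OF mem(8) mem(1) mem(2), unfolded p]
    avoid[OF mem(8) mem(9) mem(3), unfolded p] avoid[OF mem(4) mem(7) mem(2), unfolded p]
    avoid[OF mem(8) mem(9) mem(5), unfolded p] avoid[OF mem(1) mem(8) mem(9), unfolded p]
    avoid[OF mem(1) mem(7) mem(2), unfolded p]
  \<comment> \<open>If \<open>x < d\<close>, the first pattern forces \<open>f < y\<close>, and then
    the positions \<open>d < e < z\<close> carry \<open>e < f < y\<close>.\<close>
  have "d < x"
    using patterns(1,2) ord ne1(1) ne2(2) by (simp add: not_less) linarith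
  \<comment> \<open>If \<open>c < z\<close>, the positions \<open>f\<close>, \<open>c\<close>,
    \<open>z\<close> force \<open>y < a\<close>, and then \<open>y < a < b\<close> carry
    \<open>x < b < c\<close>.\<close>
  have "z < c"
    using patterns(3,4) ord ne1(3) ne2(1) by (simp add: not_less) linarith
  then have "a < y"
    using patterns(5) ord ne1(3) by (simp add: not_less)
  have "z < e"
  proof (cases "x < a")
    case True
    then show ?thesis
      using patterns(6) ord ne3(1) \<open>d < x\<close> \<open>z < c\<close> by (simp add: not_less)
  next
    case False
    \<comment> \<open>Otherwise \<open>a < y < z\<close> would carry \<open>b < x < y\<close>. With
      \<open>a < x < b\<close> in place, \<open>b < z\<close> would give a 123 at these positions,
      so \<open>z\<close> stays below \<open>e\<close>.\<close>
    then have "x < b"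
      using patterns(8) ord ne3(2) \<open>a < y\<close> by (simp add: not_less)
    then show ?thesis
      using patterns(9) ord ne1(2) False \<open>z < c\<close> by (simp add: not_less)
  qed
  then show False
    using patterns(7) ord by (simp add: not_less)
qed

lemma card_asc_minima_le_1:
  assumes "desc_minima p m \<noteq> {}"
  shows "card (asc_minima p m) \<le> 1"
proof -
  have "d = a" if "d \<in> asc_minima p m" "a \<in> asc_minima p m" for d a
    using asc_asc_desc[of d a] asc_asc_desc[of a d] that assms by (meson ex_in_conv linorder_neqE_nat)
  then show ?thesis
    by (simp add: card_le_Suc0_iff_eq)
qed

text \<open>The bounds for descending cycles are those for ascending cycles of
  \<open>p \<circ> p\<close>.\<close>

lemma few_minima: "card (asc_minima p m) + card (desc_minima p m) \<le> 2"
proof -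
  interpret inv: three_cycles_av123 "p \<circ> p" m
    by (rule inverse)
  have "card (desc_minima p m) \<le> 2"
    using inv.card_asc_minima unfolding asc_minima_inverse .
  moreover have "card (desc_minima p m) \<le> 1" if "asc_minima p m \<noteq> {}"
    using inv.card_asc_minima_le_1 that unfolding asc_minima_inverse desc_minima_inverse .
  ultimately show ?thesis
    using card_asc_minima card_asc_minima_le_1
    by (cases "asc_minima p m = {}"; cases "desc_minima p m = {}") fastforce+
qed

lemma le_3_card_minima: "m \<le> 3 * (card (asc_minima p m) + card (desc_minima p m))"
proof -
  define M where "M = asc_minima p m \<union> desc_minima p m"
  have "{1..m} \<subseteq> M \<union> (p ` M \<union> (p \<circ> p) ` M)"
  proof
    fix i assume i: "i \<in> {1..m}"
    \<comment> \<open>The least of the three elements of the cycle of \<open>i\<close> lies in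
      \<open>M\<close>; by \<open>cube\<close>, \<open>i\<close> is reached from it in at most two
      steps.\<close>
    have "i \<in> M \<or> p i \<in> M \<or> p (p i) \<in> M"
      using i closed[OF i] closed[OF closed[OF i]] no_fix[OF i] no_fix[OF closed[OF i]]
        no_fix[OF closed[OF closed[OF i]]] cube[OF i]
      unfolding M_def asc_minima_def desc_minima_def by (auto simp: neq_iff)
    then show "i \<in> M \<union> (p ` M \<union> (p \<circ> p) ` M)"
      using cube[OF i] by (metis UnCI comp_apply imageI)
  qed
  then have "card {1..m} \<le> card (M \<union> (p ` M \<union> (p \<circ> p) ` M))"
    by (intro card_mono) (auto simp: M_def)
  also have "\<dots> \<le> card M + (card (p ` M) + card ((p \<circ> p) ` M))"
    by (meson card_Un_le add_left_mono order_trans)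
  also have "\<dots> \<le> 3 * card M"
    using card_image_le[of M p] card_image_le[of M "p \<circ> p"] by (simp add: M_def)
  also have "card M \<le> card (asc_minima p m) + card (desc_minima p m)"
    unfolding M_def by (rule card_Un_le)
  finally show ?thesis by simp
qed

end

section \<open>Explicit enumeration for \<open>m = 3\<close> and \<open>m = 6\<close>\<close>

lemma one_line_3: "one_line 3 p = [p 1, p 2, p 3]"
  by (simp add: one_line_def upt_rec numeral_eq_Suc)

lemma one_line_6: "one_line 6 p = [p 1, p 2, p 3, p 4, p 5, p 6]"
  by (simp add: one_line_def upt_rec numeral_eq_Suc)

lemma inj_on_one_line: "inj_on (one_line m) {p. p permutes {1..m}}"
proof (rule inj_onI, rule ext)
  fix p q i
  assume "p \<in> {p. p permutes {1..m}}" "q \<in> {p. p permutes {1..m}}" "one_line m p = one_line m q"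
  then show "p i = q i"
    by (cases "i \<in> {1..m}") (auto simp: one_line_def permutes_not_in simp del: upt_Suc)
qed

lemma card_Av_star: "card (Av_star m \<sigma>) = card (one_line m ` Av_star m \<sigma>)"
  by (intro card_image[symmetric] inj_on_subset[OF inj_on_one_line])
     (auto simp: Av_star_def S_star_def)

text \<open>Reads a list as a function, shifting by one because list indices start at 0, and extends
  it by the identity. The extension has cube the identity everywhere, so \<open>p \<circ> p\<close>
  is its inverse.\<close>

lemma mem_one_line_Av_star_123:
  fixes xs :: "nat list" and m :: nat
  defines "p \<equiv> \<lambda>i. if i \<in> {1..m} then xs ! (i - 1) else i"
  assumes len: "length xs = m" and p: "three_cycles_av123 p m"
  shows "xs \<in> one_line m ` Av_star m [1, 2, 3]"
proof
  interpret three_cycles_av123 p m by (fact p)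
  have "p (p (p i)) = i" for i
    by (cases "i \<in> {1..m}") (use cube in \<open>auto simp: p_def\<close>)
  then have "bij p"
    by (intro o_bij[of "p \<circ> p"]) (auto simp: fun_eq_iff)
  then have "p permutes {1..m}"
    by (simp add: permutes_def bij_iff) (simp add: p_def)
  then show "p \<in> Av_star m [1, 2, 3]"
    using p Av_star_123_iff by blast
  show "xs = one_line m p"
    using len by (intro nth_equalityI) (auto simp: one_line_def p_def simp del: upt_Suc)
qed

lemma atLeastAtMost_3: "{1..3::nat} = {1, 2, 3}"
  by auto

lemma atLeastAtMost_6: "{1..6::nat} = {1, 2, 3, 4, 5, 6}"
  by auto

lemma three_cycles_av123_alt:
  "three_cycles_av123 p m \<longleftrightarrow>
     (\<forall>i\<in>{1..m}. p i \<in> {1..m} \<and> p i \<noteq> i \<and> p (p (p i)) = i) \<and>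
     (\<forall>i\<in>{1..m}. \<forall>j\<in>{1..m}. \<forall>k\<in>{1..m}. i < j \<longrightarrow> j < k \<longrightarrow> p i < p j \<longrightarrow> \<not> p j < p k)"
  unfolding three_cycles_av123_def Ball_def by blast

lemma atLeastAtMost_3_cases:
  assumes "i \<in> {1..3::nat}"
  obtains "i = 1" | "i = 2" | "i = 3"
  using assms unfolding atLeastAtMost_3 by blast

lemma one_line_Av_star_3: "one_line 3 ` Av_star 3 [1, 2, 3] = {[2, 3, 1], [3, 1, 2]}"
  (is "?L = ?R")
proof
  have "one_line 3 p \<in> ?R" if "three_cycles_av123 p 3" for p
  proof -
    interpret three_cycles_av123 p 3 by fact
    have range: "p 1 \<in> {1..3}" "p 2 \<in> {1..3}" "p 3 \<in> {1..3}"
      using closed by simp_all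
    have cycles: "\<forall>i\<in>{1..3}. p i \<noteq> i \<and> p (p (p i)) = i"
      using no_fix cube by blast
    show ?thesis
      using cycles[unfolded atLeastAtMost_3 ball_simps]
      unfolding one_line_3
      \<comment> \<open>Values are fixed one position at a time, and simplification after each
        choice discards contradictory branches early.\<close>
      by - (rule atLeastAtMost_3_cases[OF range(1)]; (simp del: One_nat_def)?;
          (rule atLeastAtMost_3_cases[OF range(2)]; (simp del: One_nat_def)?;
          (rule atLeastAtMost_3_cases[OF range(3)]; (simp del: One_nat_def)?)))
  qed
  then show "?L \<subseteq> ?R"
    unfolding image_subset_iff Ball_def Av_star_123_iff by blast
next
  show "?R \<subseteq> ?L"
    unfolding insert_subset
    by (intro conjI empty_subsetI mem_one_line_Av_star_123;
        (unfold three_cycles_av123_alt atLeastAtMost_3)?; simp)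
qed

lemma atLeastAtMost_6_cases:
  assumes "i \<in> {1..6::nat}"
  obtains "i = 1" | "i = 2" | "i = 3" | "i = 4" | "i = 5" | "i = 6"
  using assms unfolding atLeastAtMost_6 by blast

text \<open>Keeps only the 20 increasing triples out of 216, so that simplification stays
  feasible.\<close>

lemma increasing_triples_6:
  "(\<forall>i\<in>{1..6::nat}. \<forall>j\<in>{1..6}. \<forall>k\<in>{1..6}. i < j \<longrightarrow> j < k \<longrightarrow> P i j k) \<longleftrightarrow>
   (\<forall>(i, j, k) \<in> {(1, 2, 3), (1, 2, 4), (1, 2, 5), (1, 2, 6), (1, 3, 4), (1, 3, 5), (1, 3, 6),
      (1, 4, 5), (1, 4, 6), (1, 5, 6), (2, 3, 4), (2, 3, 5), (2, 3, 6), (2, 4, 5), (2, 4, 6),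
      (2, 5, 6), (3, 4, 5), (3, 4, 6), (3, 5, 6), (4, 5, 6)}. P i j k)"
  unfolding atLeastAtMost_6 by (simp del: One_nat_def)

lemma one_line_Av_star_6:
  "one_line 6 ` Av_star 6 [1, 2, 3] =
     {[3, 6, 5, 2, 1, 4], [4, 3, 6, 5, 1, 2], [4, 6, 2, 5, 1, 3],
      [5, 3, 6, 1, 4, 2], [5, 4, 1, 6, 3, 2], [5, 6, 2, 1, 4, 3]}" (is "?L = ?R")
proof
  have "one_line 6 p \<in> ?R" if "three_cycles_av123 p 6" for p
  proof -
    interpret three_cycles_av123 p 6 by fact
    have range: "p 1 \<in> {1..6}" "p 2 \<in> {1..6}" "p 3 \<in> {1..6}"
      "p 4 \<in> {1..6}" "p 5 \<in> {1..6}" "p 6 \<in> {1..6}"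
      using closed by simp_all
    have cycles: "\<forall>i\<in>{1..6}. p i \<noteq> i \<and> p (p (p i)) = i"
      using no_fix cube by blast
    have triples: "\<forall>i\<in>{1..6}. \<forall>j\<in>{1..6}. \<forall>k\<in>{1..6}. i < j \<longrightarrow> j < k \<longrightarrow>
        p i < p j \<longrightarrow> \<not> p j < p k"
      using no_123 by meson
    \<comment> \<open>Otherwise linear arithmetic splits on all the order hypotheses at once.\<close>
    note [[linarith_neq_limit = 0, linarith_split_limit = 0]]
    show ?thesis
      using triples[unfolded increasing_triples_6, unfolded ball_simps prod.case]
        cycles[unfolded atLeastAtMost_6 ball_simps]
      unfolding one_line_6
      by - (rule atLeastAtMost_6_cases[OF range(1)]; (simp del: One_nat_def)?;
          (rule atLeastAtMost_6_cases[OF range(2)]; (simp del: One_nat_def)?;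
          (rule atLeastAtMost_6_cases[OF range(3)]; (simp del: One_nat_def)?;
          (rule atLeastAtMost_6_cases[OF range(4)]; (simp del: One_nat_def)?;
          (rule atLeastAtMost_6_cases[OF range(5)]; (simp del: One_nat_def)?;
          (rule atLeastAtMost_6_cases[OF range(6)]; (simp del: One_nat_def)?))))))
  qed
  then show "?L \<subseteq> ?R"
    unfolding image_subset_iff Ball_def Av_star_123_iff by blast
next
  show "?R \<subseteq> ?L"
    unfolding insert_subset
    by (intro conjI empty_subsetI mem_one_line_Av_star_123;
        (unfold three_cycles_av123_alt increasing_triples_6 atLeastAtMost_6)?; simp)
qed

theorem theorem5p1:
  shows "(\<forall>n::nat. n \<ge> 3 \<longrightarrow> card (Av_star (3 * n) [1, 2, 3]) = 0) \<and>
         card (Av_star 3 [1, 2, 3]) = 2 \<and>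
         card (Av_star 6 [1, 2, 3]) = 6"
proof (intro conjI allI impI)
  fix n :: nat
  assume n: "n \<ge> 3"
  have False if "p \<in> Av_star (3 * n) [1, 2, 3]" for p
  proof -
    interpret three_cycles_av123 p "3 * n"
      using that Av_star_123_iff by blast
    \<comment> \<open>At most two cycles cover at most six points, but \<open>3 * n\<close> is at
      least nine.\<close>
    show False
      using le_3_card_minima n few_minima by simp
  qed
  then show "card (Av_star (3 * n) [1, 2, 3]) = 0"
    by (metis card.empty equals0I)
next
  show "card (Av_star 3 [1, 2, 3]) = 2" "card (Av_star 6 [1, 2, 3]) = 6"
    unfolding card_Av_star one_line_Av_star_3 one_line_Av_star_6 by simp_all
qed

end
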